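(* Let $\mathscr{P}$ be a nondegenerate flexible suspension in Lobachevsky (hyperbolic) $3$-space $\mathbb{H}^3$ with poles $N$ and $S$, and with vertices of the equator $P_j$, $j=1,\dots,V$. Put $P_{V+1}:=P_1$ and let $e_{j,j+1}:=\mathrm{d}_{\mathbb{H}^3}(P_j,P_{j+1})$ denote the length of the equator edge $P_jP_{j+1}$, $j=1,\dots,V$ (so $e_{V,V+1}$ is the length of $P_VP_1$). Then there exist signs $\sigma_{j,j+1}\in\{+1,-1\}$, $j=1,\dots,V$, such that $$\sum_{j=1}^{V}\sigma_{j,j+1}\,e_{j,j+1}=0.$$
   Context: $\mathbb{H}^3$ is hyperbolic $3$-space (curvature $-1$) with distance $\mathrm{d}_{\mathbb{H}^3}$. **Polyhedra.** Let $\mathscr{K}$ be a simplicial complex of dimension at most $2$ with vertices $v_1,\dots,v_W$. A polyhedron (polyhedral surface) in $\mathbb{H}^3$ is a continuous map $\mathscr{P}:\mathscr{K}\to\mathbb{H}^3$ sending every $k$-dimensional simplex of $\mathscr{K}$ into a subset of a $k$-dimensional plane of $\mathbb{H}^3$ ($k\le 2$). Images of simplices may be degenerate, and faces may intersect in their interior points. A polyhedron is regarded as determined by its vertices $P_j:=\mathscr{P}(v_j)\in\mathbb{H}^3$, $j=1,\dots,W$. The length of the edge corresponding to a $1$-simplex $\langle v_j,v_k\rangle$ is $\mathrm{d}_{\mathbb{H}^3}(P_j,P_k)$. **Congruent and isometric polyhedra.** Let $\mathscr{P},\mathscr{Q}:\mathscr{K}\to\mathbb{H}^3$ be polyhedra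 with vertices $P_j$, $Q_j$. - They are congruent if there is an isometry (motion) $\mathscr{A}$ of $\mathbb{H}^3$ with $Q_j=\mathscr{A}(P_j)$ for all $j$. - They are isometric (in the intrinsic metric) if $\mathrm{d}_{\mathbb{H}^3}(Q_j,Q_k)=\mathrm{d}_{\mathbb{H}^3}(P_j,P_k)$ for every $1$-simplex $\langle v_j,v_k\rangle$ of $\mathscr{K}$. **Flexibility.** A polyhedron $\mathscr{P}$ is flexible if there is a continuous one-parameter family of polyhedra $\mathscr{P}_t:\mathscr{K}\to\mathbb{H}^3$, $0\le t\le 1$ (so each vertex $\mathscr{P}_t(v_j)$ depends continuously on $t$), such that (1) $\mathscr{P}_0=\mathscr{P}$; (2) each $\mathscr{P}_t$ is isometric to $\mathscr{P}_0$; (3) some $\mathscr{P}_t$ is not congruent to $\mathscr{P}_0$. **Suspensions.** Let $\mathscr{K}$ have vertices $v_0,v_1,\dots,v_V,v_{V+1}$ with $V\geq 3$, where $v_1,\dots,v_V$ form a cycle ($v_j$ is adjacent to $v_{j+1}$ for $j=1,\dots,V-1$, and $v_V$ is adjacent to $v_1$), and $v_0$ and $v_{V+1}$ are each adjacent to all of $v_1,\dots,v_V$ (and there are no other edges). The $2$-simplices are the triangles spanned by $v_0$ or $v_{V+1}$ together with an edge of the cycle. A polyhedron $\mathscr{P}$ based on such a $\mathscr{K}$ is called a suspension. Its poles are $N:=\mathscr{P}(v_0)$ (north) and $S:=\mathscr{P}(v_{V+1})$ (south), and $P_j:=\mathscr{P}(v_j)$, $j=1,\dots,V$, are the vertices of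 its equator. **Nondegeneracy.** A suspension is nondegenerate if none of the $V$ tetrahedra $NSP_jP_{j+1}$, $j=1,\dots,V$ (with $P_{V+1}:=P_1$), lies in a hyperbolic $2$-plane, i.e. for each $j$ the four points $N,S,P_j,P_{j+1}$ are not contained in a common hyperbolic $2$-plane. *)

theory Defs
  imports "HOL-Analysis.Analysis"
begin

text \<open>Hyperbolic 3-space of curvature -1 is taken in the hyperboloid model: the upper sheet
  of \<open>v \<bullet> v - t\<^sup>2 = -1\<close> in Minkowski space, whose points are written \<open>(t, v)\<close> with time
  coordinate \<open>t\<close>.  The topology induced by \<open>hdist\<close> on \<open>hyp3\<close> is the subspace topology
  of the ambient space, so continuity below is the ordinary one.\<close>

type_synonym minkowski = "real \<times> (real ^ 3)"

definition mink :: "minkowski \<Rightarrow> minkowski \<Rightarrow> real" where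
  "mink x y = snd x \<bullet> snd y - fst x * fst y"

definition hyp3 :: "minkowski set" where
  "hyp3 = {x. mink x x = - 1 \<and> 0 < fst x}"

definition hdist :: "minkowski \<Rightarrow> minkowski \<Rightarrow> real" where
  "hdist x y = arcosh (- mink x y)"

text \<open>The \<open>k\<close>-planes of the hyperboloid are its nonempty sections by linear
  subspaces of dimension \<open>k + 1\<close>.\<close>

definition hyp_plane :: "nat \<Rightarrow> minkowski set \<Rightarrow> bool" where
  "hyp_plane k A \<longleftrightarrow> (\<exists>L. subspace L \<and> dim L = k + 1 \<and> A = L \<inter> hyp3 \<and> A \<noteq> {})"

definition hyp_isometry :: "(minkowski \<Rightarrow> minkowski) \<Rightarrow> bool" where
  "hyp_isometry f \<longleftrightarrow>
     bij_betw f hyp3 hyp3 \<and> (\<forall>x\<in>hyp3. \<forall>y\<in>hyp3. hdist (f x) (f y) = hdist x y)"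

definition simplicial_complex :: "'v set set \<Rightarrow> bool" where
  "simplicial_complex K \<longleftrightarrow>
     finite K \<and> (\<forall>s\<in>K. finite s \<and> s \<noteq> {}) \<and> (\<forall>s\<in>K. \<forall>r. r \<subseteq> s \<and> r \<noteq> {} \<longrightarrow> r \<in> K)"

text \<open>Geometric realization in barycentric coordinates.  Functions carry the product topology;
  for a finite complex this gives the usual topology of the realization.\<close>

definition geom_simplex :: "'v set \<Rightarrow> ('v \<Rightarrow> real) set" where
  "geom_simplex s = {x. (\<forall>v. 0 \<le> x v) \<and> (\<forall>v. v \<notin> s \<longrightarrow> x v = 0) \<and> sum x s = 1}"

definition realization :: "'v set set \<Rightarrow> ('v \<Rightarrow> real) set" where
  "realization K = (\<Union>s\<in>K. geom_simplex s)"

definition vertex_pt :: "'v \<Rightarrow> 'v \<Rightarrow> real" where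
  "vertex_pt v = (\<lambda>w. if w = v then 1 else 0)"

text \<open>A simplex \<open>s\<close> has dimension \<open>card s - 1\<close>.\<close>

definition polyhedron :: "'v set set \<Rightarrow> (('v \<Rightarrow> real) \<Rightarrow> minkowski) \<Rightarrow> bool" where
  "polyhedron K P \<longleftrightarrow>
     simplicial_complex K \<and> (\<forall>s\<in>K. card s \<le> 3) \<and>
     P ` realization K \<subseteq> hyp3 \<and> continuous_on (realization K) P \<and>
     (\<forall>s\<in>K. \<exists>A. hyp_plane (card s - 1) A \<and> P ` geom_simplex s \<subseteq> A)"

definition congruent_polyhedra ::
  "'v set set \<Rightarrow> (('v \<Rightarrow> real) \<Rightarrow> minkowski) \<Rightarrow> (('v \<Rightarrow> real) \<Rightarrow> minkowski) \<Rightarrow> bool" where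
  "congruent_polyhedra K P Q \<longleftrightarrow>
     (\<exists>f. hyp_isometry f \<and> (\<forall>v\<in>\<Union>K. Q (vertex_pt v) = f (P (vertex_pt v))))"

definition isometric_polyhedra ::
  "'v set set \<Rightarrow> (('v \<Rightarrow> real) \<Rightarrow> minkowski) \<Rightarrow> (('v \<Rightarrow> real) \<Rightarrow> minkowski) \<Rightarrow> bool" where
  "isometric_polyhedra K P Q \<longleftrightarrow>
     (\<forall>v w. v \<noteq> w \<and> {v, w} \<in> K \<longrightarrow>
        hdist (Q (vertex_pt v)) (Q (vertex_pt w)) = hdist (P (vertex_pt v)) (P (vertex_pt w)))"

text \<open>As polyhedra are regarded as determined by their vertices, continuity in the parameter is
  required of the vertices only.\<close>

definition flexible :: "'v set set \<Rightarrow> (('v \<Rightarrow> real) \<Rightarrow> minkowski) \<Rightarrow> bool" where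
  "flexible K P \<longleftrightarrow>
     (\<exists>F :: real \<Rightarrow> ('v \<Rightarrow> real) \<Rightarrow> minkowski.
        (\<forall>t\<in>{0..1}. polyhedron K (F t)) \<and>
        (\<forall>v\<in>\<Union>K. continuous_on {0..1} (\<lambda>t. F t (vertex_pt v))) \<and>
        (\<forall>x\<in>realization K. F 0 x = P x) \<and>
        (\<forall>t\<in>{0..1}. isometric_polyhedra K (F 0) (F t)) \<and>
        (\<exists>t\<in>{0..1}. \<not> congruent_polyhedra K (F 0) (F t)))"

text \<open>The complex of a suspension: equator \<open>1, \<dots>, V\<close> in cyclic order, poles \<open>0\<close>
  and \<open>V + 1\<close>; every simplex is a face of a triangle spanned by a pole and an equator edge.\<close>

definition equator_next :: "nat \<Rightarrow> nat \<Rightarrow> nat" where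
  "equator_next V j = (if j = V then 1 else j + 1)"

definition suspension_complex :: "nat \<Rightarrow> nat set set" where
  "suspension_complex V =
     {s. s \<noteq> {} \<and> (\<exists>p\<in>{0, V + 1}. \<exists>j\<in>{1..V}. s \<subseteq> {p, j, equator_next V j})}"

definition suspension :: "nat \<Rightarrow> ((nat \<Rightarrow> real) \<Rightarrow> minkowski) \<Rightarrow> bool" where
  "suspension V P \<longleftrightarrow> 3 \<le> V \<and> polyhedron (suspension_complex V) P"

definition nondegenerate_suspension :: "nat \<Rightarrow> ((nat \<Rightarrow> real) \<Rightarrow> minkowski) \<Rightarrow> bool" where
  "nondegenerate_suspension V P \<longleftrightarrow>
     (\<forall>j\<in>{1..V}. \<not> (\<exists>A. hyp_plane 2 A \<and>
        {P (vertex_pt 0), P (vertex_pt (V + 1)),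
         P (vertex_pt j), P (vertex_pt (equator_next V j))} \<subseteq> A))"

lemma simplicial_complex_suspension_complex: "simplicial_complex (suspension_complex V)"
proof -
  have "suspension_complex V \<subseteq>
      (\<Union>p\<in>{0, V + 1}. \<Union>j\<in>{1..V}. Pow {p, j, equator_next V j})"
    by (auto simp: suspension_complex_def)
  then have "finite (suspension_complex V)"
    by (rule finite_subset) auto
  moreover have "finite s" if "s \<in> suspension_complex V" for s
    using that by (auto simp: suspension_complex_def intro: finite_subset)
  moreover have "r \<in> suspension_complex V"
    if "s \<in> suspension_complex V" "r \<subseteq> s" "r \<noteq> {}" for r s
    using that unfolding suspension_complex_def by blast
  ultimately show ?thesis
    by (auto simp: simplicial_complex_def suspension_complex_def)
qed

lemma card_suspension_complex:
  assumes "s \<in> suspension_complex V"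
  shows "card s \<le> 3"
proof -
  obtain p j where "s \<subseteq> {p, j, equator_next V j}"
    using assms by (auto simp: suspension_complex_def)
  then have "card s \<le> card {p, j, equator_next V j}"
    by (intro card_mono) auto
  also have "\<dots> \<le> 3"
    by (auto simp: card_insert_if)
  finally show ?thesis .
qed

end

theory Submission
  imports Defs "HOL-Computational_Algebra.Polynomial"
begin

text \<open>
  Fix a position of the suspension with distinct poles, and let \<open>x > 1\<close> be the hyperbolic
  cosine of the distance between them.  The Minkowski-orthogonal complement of the plane spanned
  by the poles \<open>N\<close>, \<open>S\<close> is a Euclidean plane, that is, a copy of the complex numbers;
  let \<open>z\<^sub>j\<close> be the projection of \<open>P\<^sub>j\<close> to it, suitably scaled.  Since the equator closes up,
  the product of all \<open>cnj z\<^sub>j * z\<^bsub>j+1\<^esub>\<close> equals the product of all \<open>\<bar>z\<^sub>j\<bar>\<^sup>2\<close>; this is the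
  statement that the dihedral angles at the axis \<open>NS\<close> add up to a multiple of \<open>2\<pi>\<close>.
  The point is how the factors depend on the position.  With \<open>y = 1/x\<close>, the real part of
  \<open>cnj z\<^sub>j * z\<^bsub>j+1\<^esub>\<close> is a quadratic polynomial \<open>F\<^sub>j y\<close>, and \<open>\<bar>z\<^sub>j\<bar>\<^sup>2\<close> is a quadratic
  polynomial \<open>G\<^sub>j y\<close>, with coefficients that depend only on edge lengths and so do not change
  during a flex (\<open>axial_projection\<close>).  Hence
  \<open>(\<Prod>j. F\<^sub>j y + r\<^sub>j) = (\<Prod>j. G\<^sub>j y)\<close>, with \<open>r\<^sub>j\<^sup>2 = (F\<^sub>j y)\<^sup>2 - G\<^sub>j y * G\<^bsub>j+1\<^esub> y\<close>,
  for suitable square roots \<open>r\<^sub>j\<close>.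

  If the distance of the poles varies during the flex, this holds for infinitely many \<open>y\<close>.
  Multiplying the conjugates of such a relation under the sign changes of the roots produces
  a polynomial in \<open>y\<close> alone, which vanishes at \<open>y\<close> if and only if the relation holds at \<open>y\<close> for
  some choice of the roots (\<open>multiquadratic_norm\<close>).  A polynomial with infinitely many zeros is
  zero, so the relation can also be solved at \<open>y = 0\<close>, the position with poles infinitely far apart
  (\<open>closing_relation_at_zero\<close>).  There, for an equator edge of length \<open>e\<close>, one has
  \<open>F = - cosh e\<close>, \<open>G = - 1\<close> and \<open>r = \<plusminus> sinh e\<close>, so that every factor on the left is \<open>- exp (\<plusminus> e)\<close>.
  The relation says that a signed sum of the edge lengths has exponential \<open>1\<close>, that is, vanishes.

  If the distance of the poles were constant, the relations above would leave only finitely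
  many values for each \<open>cnj z\<^sub>j * z\<^sub>k\<close>, hence for each distance between vertices.  These distances are
  continuous in time, so they would be constant.  As nondegeneracy makes the vertices span
  Minkowski space, all positions would be congruent (\<open>isometry_of_equal_gram\<close>), contradicting
  flexibility.
\<close>

section \<open>Minkowski space and the hyperboloid\<close>

lemma mink_commute: "mink x y = mink y x"
  by (simp add: mink_def inner_commute mult.commute)

lemma mink_linear_simps [simp]:
  "mink (x + y) z = mink x z + mink y z" "mink z (x + y) = mink z x + mink z y"
  "mink (x - y) z = mink x z - mink y z" "mink z (x - y) = mink z x - mink z y"
  "mink (c *\<^sub>R x) z = c * mink x z" "mink z (c *\<^sub>R x) = c * mink z x"
  "mink (- x) z = - mink x z" "mink z (- x) = - mink z x"
  "mink 0 z = 0" "mink z 0 = 0"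
  by (auto simp: mink_def algebra_simps inner_simps)

lemma mink_inner: "mink x y = x \<bullet> (- fst y, snd y)"
  by (simp add: mink_def inner_prod_def)

lemma mink_nondegenerate:
  assumes "\<And>y. mink x y = 0"
  shows "x = 0"
proof -
  have "x \<bullet> x = mink x (- fst x, snd x)" by (simp add: mink_inner)
  then show ?thesis using assms by simp
qed

lemma hyp3_D: "x \<in> hyp3 \<Longrightarrow> mink x x = - 1" "x \<in> hyp3 \<Longrightarrow> fst x > 0"
  by (auto simp: hyp3_def)

text \<open>The complement of a time-like vector is space-like, by the Cauchy--Schwarz inequality applied
  to the space components.\<close>

lemma mink_pos_of_orthogonal:
  assumes N: "N \<in> hyp3" and uN: "mink u N = 0" and u: "u \<noteq> 0"
  shows "mink u u > 0"
proof -
  obtain s v where us: "u = (s, v)" by (cases u)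
  obtain t n where Nt: "N = (t, n)" by (cases N)
  have t: "t > 0" and tn: "t\<^sup>2 = 1 + (norm n)\<^sup>2"
    using hyp3_D[OF N] by (auto simp: Nt mink_def power2_norm_eq_inner power2_eq_square[of t])
  have st: "v \<bullet> n = s * t" using uN by (simp add: us Nt mink_def)
  have "\<bar>s * t\<bar> \<le> norm v * norm n"
    using Cauchy_Schwarz_ineq2[of v n] by (simp add: st)
  then have "(s * t)\<^sup>2 \<le> (norm v * norm n)\<^sup>2"
    by (metis abs_ge_zero power2_abs power_mono)
  then have le: "s\<^sup>2 * t\<^sup>2 \<le> (norm v)\<^sup>2 * t\<^sup>2 - (norm v)\<^sup>2"
    by (simp add: tn power_mult_distrib algebra_simps)
  have "v \<noteq> 0" using st t u by (auto simp: us zero_prod_def)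
  then have "s\<^sup>2 * t\<^sup>2 < (norm v)\<^sup>2 * t\<^sup>2" using le by (smt (verit) zero_less_norm_iff zero_less_power)
  then have "s\<^sup>2 < (norm v)\<^sup>2" using t by simp
  then show ?thesis by (simp add: us mink_def power2_norm_eq_inner power2_eq_square[of s])
qed

text \<open>The reversed Cauchy--Schwarz inequality for time-like vectors.  It makes \<open>hdist\<close> on \<open>hyp3\<close> carry the
  same information as \<open>mink\<close>, since \<open>arcosh\<close> is injective on \<open>{1..}\<close>.\<close>

lemma mink_hyp3_le:
  assumes x: "x \<in> hyp3" and y: "y \<in> hyp3"
  shows "mink x y \<le> - 1"
proof -
  obtain t n where xt: "x = (t, n)" by (cases x)
  obtain s m where ys: "y = (s, m)" by (cases y)
  have t: "t > 0" "(norm n)\<^sup>2 = t\<^sup>2 - 1" and s: "s > 0" "(norm m)\<^sup>2 = s\<^sup>2 - 1"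
    using hyp3_D[OF x] hyp3_D[OF y]
    by (auto simp: xt ys mink_def power2_norm_eq_inner power2_eq_square[of t] power2_eq_square[of s])
  have "t\<^sup>2 \<ge> 1" "s\<^sup>2 \<ge> 1" using t(2) s(2) zero_le_power2[of "norm n"] zero_le_power2[of "norm m"] by linarith+
  then have "1 \<le> t" "1 \<le> s" using t(1) s(1) by (simp_all add: abs_square_le_1 one_le_power power2_ge_1_iff)
  then have ts: "t * s \<ge> 1" by (metis mult_mono' mult_1 zero_le_one)
  have "(n \<bullet> m)\<^sup>2 \<le> (t\<^sup>2 - 1) * (s\<^sup>2 - 1)"
    using Cauchy_Schwarz_ineq[of n m] by (simp add: dot_square_norm t s)
  also have "\<dots> = (t * s - 1)\<^sup>2 - (t - s)\<^sup>2" by (simp add: power2_eq_square algebra_simps)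
  also have "\<dots> \<le> (t * s - 1)\<^sup>2" by simp
  finally have "n \<bullet> m \<le> t * s - 1" using ts by (meson diff_ge_0_iff_ge power2_le_imp_le)
  then show ?thesis by (simp add: xt ys mink_def)
qed

lemma mink_hyp3_eq:
  assumes x: "x \<in> hyp3" and y: "y \<in> hyp3" and "mink x y = - 1"
  shows "x = y"
proof (rule ccontr)
  assume "x \<noteq> y"
  then have "mink (x - y) (x - y) > 0"
    using assms hyp3_D by (intro mink_pos_of_orthogonal[of x]) (auto simp: mink_commute)
  then show False using assms hyp3_D by (auto simp: mink_commute)
qed

lemma hdist_eq_iff:
  assumes "x \<in> hyp3" "y \<in> hyp3" "x' \<in> hyp3" "y' \<in> hyp3"
  shows "hdist x y = hdist x' y' \<longleftrightarrow> mink x y = mink x' y'"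
  by (metis assms cosh_arcosh_real hdist_def mink_hyp3_le minus_equation_iff neg_le_iff_le)

text \<open>A set that does not span lies in a linear hyperplane, and linear hyperplanes cut the hyperboloid in
  2-planes; thus nondegeneracy is a statement about linear span.\<close>

lemma span_eq_UNIV_if_no_plane:
  assumes X: "X \<subseteq> hyp3" "X \<noteq> {}" and no: "\<not> (\<exists>A. hyp_plane 2 A \<and> X \<subseteq> A)"
  shows "span X = UNIV"
proof (rule ccontr)
  assume "span X \<noteq> UNIV"
  then obtain a where a: "a \<noteq> 0" "span X \<subseteq> {x. a \<bullet> x = 0}"
    using span_not_univ_subset_hyperplane by blast
  let ?L = "{x. a \<bullet> x = 0}"
  have "X \<subseteq> ?L \<inter> hyp3" using a X span_superset by blast
  moreover have "hyp_plane 2 (?L \<inter> hyp3)"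
    unfolding hyp_plane_def using X(2) calculation
    by (intro exI[of _ ?L]) (auto simp: subspace_hyperplane dim_hyperplane[OF a(1)])
  ultimately show False using no by blast
qed

section \<open>Projection along the axis\<close>

text \<open>For \<open>y = 1/x\<close> with \<open>x = - mink N S\<close>, this is \<open>1 - y\<^sup>2\<close> times the product of the components of \<open>A\<close> and
  \<open>B\<close> orthogonal to \<open>N\<close> and \<open>S\<close>, where \<open>m = mink A B\<close> and \<open>(a, b)\<close>, \<open>(a', b')\<close> are the products of \<open>A\<close> and of
  \<open>B\<close> with \<open>(N, S)\<close>.  The factor clears the denominator, so that the expression is polynomial in
  \<open>y\<close>, and the reciprocal variable turns the behaviour for distant poles into a value at \<open>0\<close>.\<close>

definition axial_gram :: "real \<Rightarrow> real \<Rightarrow> real \<Rightarrow> real \<Rightarrow> real \<Rightarrow> real \<Rightarrow> real" where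
  "axial_gram y m a b a' b' = (1 - y\<^sup>2) * m + y * (a * b' + b * a') - y\<^sup>2 * (a * a' + b * b')"

text \<open>Here \<open>\<gamma> N + \<delta> S\<close> is the component in the span of \<open>N\<close> and \<open>S\<close> of a vector with products \<open>a\<close>, \<open>b\<close> with
  \<open>N\<close>, \<open>S\<close>: the formulas solve the linear system with matrix \<open>(- 1, - x; - x, - 1)\<close>.\<close>

lemma axial_gram_projection:
  assumes x: "x > 1"
    and g: "\<gamma> = (a - x * b) / (x\<^sup>2 - 1)" and d: "\<delta> = (b - x * a) / (x\<^sup>2 - 1)"
  shows "(1 - 1 / x\<^sup>2) * (m - \<gamma> * a' - \<delta> * b') = axial_gram (1 / x) m a b a' b'"
proof -
  have x2: "x\<^sup>2 - 1 \<noteq> 0" using x by (simp add: power2_eq_1_iff)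
  have k: "(x\<^sup>2 - 1) * \<gamma> = a - x * b" "(x\<^sup>2 - 1) * \<delta> = b - x * a"
    using x2 by (auto simp: g d)
  have "x\<^sup>2 * ((1 - 1 / x\<^sup>2) * (m - \<gamma> * a' - \<delta> * b'))
      = (x\<^sup>2 - 1) * m - ((x\<^sup>2 - 1) * \<gamma>) * a' - ((x\<^sup>2 - 1) * \<delta>) * b'"
    using x by (simp add: field_simps)
  also have "\<dots> = x\<^sup>2 * axial_gram (1 / x) m a b a' b'"
    unfolding k axial_gram_def using x by (simp add: field_simps power2_eq_square)
  finally show ?thesis using x by simp
qed

lemma obtain_unit_orthogonal:
  assumes N: "N \<in> hyp3"
  obtains u where "mink u u = 1" "mink u N = 0" "mink u p = 0" "mink u q = 0"
proof -
  \<comment> \<open>Euclidean orthogonality to \<open>J w\<close> is Minkowski orthogonality to \<open>w\<close>, and three vectors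
    do not exhaust the four dimensions.\<close>
  define J :: "minkowski \<Rightarrow> minkowski" where "J v = (- fst v, snd v)" for v
  have "dim {J N, J p, J q} \<le> card {J N, J p, J q}"
    by (rule dim_le_card) (auto simp: span_superset)
  also have "\<dots> \<le> 3" by (auto simp: card_insert_if)
  finally have "dim {J N, J p, J q} < DIM(minkowski)" by simp
  then obtain v where v: "v \<noteq> 0" "\<And>w. w \<in> span {J N, J p, J q} \<Longrightarrow> orthogonal v w"
    using orthogonal_to_subspace_exists by blast
  have *: "mink v N = 0" "mink v p = 0" "mink v q = 0"
    using v(2)[of "J N"] v(2)[of "J p"] v(2)[of "J q"]
    by (auto simp: span_base mink_inner J_def orthogonal_def)
  have pos: "mink v v > 0" using mink_pos_of_orthogonal[OF N *(1) v(1)] .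
  show thesis
    by (rule that[of "(1 / sqrt (mink v v)) *\<^sub>R v"]) (use * pos in \<open>auto simp: field_simps\<close>)
qed

text \<open>The poles and an orthonormal pair in their complement have an invertible Gram matrix, so the
  four coordinates \<open>mink v N\<close>, \<open>mink v S\<close>, \<open>mink v u\<close>, \<open>mink v w\<close> define a surjective linear
  endomorphism of Minkowski space, which is then injective.\<close>

lemma mink_eq_0_of_frame:
  assumes N: "mink N N = -1" and S: "mink S S = -1" and NS: "mink N S = - x" and x: "x > 1"
    and u: "mink u u = 1" "mink u N = 0" "mink u S = 0"
    and w: "mink w w = 1" "mink w N = 0" "mink w S = 0" "mink w u = 0"
    and R: "mink R N = 0" "mink R S = 0" "mink R u = 0" "mink R w = 0"
  shows "R = 0"
proof -
  define L :: "minkowski \<Rightarrow> minkowski" where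
    "L v = (mink v N, vector [mink v S, mink v u, mink v w])" for v
  have lin: "linear L"
    by (rule linearI) (auto simp: L_def vec_eq_iff forall_3 vector_3)
  have x2: "x\<^sup>2 - 1 > 0" using x by (simp add: power2_eq_square less_1_mult)
  have nx: "x * x \<noteq> 1" "x\<^sup>2 \<noteq> 1" using x2 by (auto simp: power2_eq_square)
  have "surj L"
  proof (rule surjI)
    fix q :: minkowski
    let ?a = "fst q" and ?b = "snd q $ 1"
    show "L (((?a - x * ?b) / (x\<^sup>2 - 1)) *\<^sub>R N + ((?b - x * ?a) / (x\<^sup>2 - 1)) *\<^sub>R S
        + (snd q $ 2) *\<^sub>R u + (snd q $ 3) *\<^sub>R w) = q"
      using x2 nx assms
      by (auto simp: L_def prod_eq_iff vec_eq_iff forall_3 vector_3 mink_commute[of S N]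
          mink_commute[of N u] mink_commute[of S u] mink_commute[of N w] mink_commute[of S w]
          mink_commute[of u w] divide_simps)
        (auto simp: power2_eq_square algebra_simps)
  qed
  then have "inj L" using lin by (simp add: linear_surjective_imp_injective)
  moreover have "L R = L 0" by (simp add: L_def R)
  ultimately show ?thesis by (simp add: inj_eq)
qed

text \<open>Expand vectors in the poles and an orthonormal basis \<open>u\<close>, \<open>w\<close> of their complement; \<open>z\<close> collects the last
  two coordinates and is scaled by \<open>sqrt (1 - y\<^sup>2)\<close>.\<close>

lemma axial_projection:
  assumes N: "N \<in> hyp3" and S: "S \<in> hyp3" and NS: "mink N S < -1"
  obtains z :: "minkowski \<Rightarrow> complex" where
    "\<And>A B. Re (cnj (z A) * z B)
       = axial_gram (- 1 / mink N S) (mink A B) (mink A N) (mink A S) (mink B N) (mink B S)"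
proof -
  define x where "x = - mink N S"
  have x: "x > 1" and NS': "mink N S = - x" using NS by (auto simp: x_def)
  have x2: "x\<^sup>2 - 1 > 0" using x by (simp add: power2_eq_square less_1_mult)
  obtain u where u: "mink u u = 1" "mink u N = 0" "mink u S = 0"
    using obtain_unit_orthogonal[OF N, of S S] by metis
  obtain w where w: "mink w w = 1" "mink w N = 0" "mink w S = 0" "mink w u = 0"
    using obtain_unit_orthogonal[OF N, of S u] by metis
  define z where "z A = of_real (sqrt (1 - 1 / x\<^sup>2)) * Complex (mink A u) (mink A w)" for A
  have y: "1 - 1 / x\<^sup>2 \<ge> 0" using x by simp
  note comm = mink_commute[of S N] mink_commute[of N u] mink_commute[of S u]
    mink_commute[of N w] mink_commute[of S w] mink_commute[of u w]
  show thesis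
  proof (rule that[of z])
    fix A B
    define a b a' b' where ab: "a = mink A N" "b = mink A S" "a' = mink B N" "b' = mink B S"
    define \<gamma> \<delta> where gd: "\<gamma> = (a - x * b) / (x\<^sup>2 - 1)" "\<delta> = (b - x * a) / (x\<^sup>2 - 1)"
    define R where "R = A - (\<gamma> *\<^sub>R N + \<delta> *\<^sub>R S + mink A u *\<^sub>R u + mink A w *\<^sub>R w)"
    have g1: "- \<gamma> - x * \<delta> = a" "- x * \<gamma> - \<delta> = b"
      unfolding gd using x2 by (auto simp: divide_simps) (auto simp: power2_eq_square algebra_simps)
    have "R = 0"
      using g1 hyp3_D[OF N] hyp3_D[OF S] u w NS'
      by (intro mink_eq_0_of_frame[of N S x u w R] x) (auto simp: R_def ab comm algebra_simps)
    then have A: "A = \<gamma> *\<^sub>R N + \<delta> *\<^sub>R S + mink A u *\<^sub>R u + mink A w *\<^sub>R w"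
      by (simp add: R_def)
    have "mink A B = \<gamma> * a' + \<delta> * b' + mink A u * mink B u + mink A w * mink B w"
      by (subst A) (simp add: ab mink_commute[of _ B])
    then have m: "mink A u * mink B u + mink A w * mink B w = mink A B - \<gamma> * a' - \<delta> * b'"
      by simp
    have "Re (cnj (z A) * z B)
        = (sqrt (1 - 1 / x\<^sup>2))\<^sup>2 * (mink A u * mink B u + mink A w * mink B w)"
      by (simp add: z_def power2_eq_square algebra_simps)
    also have "\<dots> = (1 - 1 / x\<^sup>2) * (mink A B - \<gamma> * a' - \<delta> * b')"
      unfolding m using y by simp
    also have "\<dots> = axial_gram (1 / x) (mink A B) a b a' b'"
      by (rule axial_gram_projection[OF x gd])
    finally show "Re (cnj (z A) * z B)
       = axial_gram (- 1 / mink N S) (mink A B) (mink A N) (mink A S) (mink B N) (mink B S)"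
      by (simp add: ab NS')
  qed
qed

text \<open>The component orthogonal to the poles is space-like, so it vanishes with its square.\<close>

lemma axial_gram_eq_0_imp_span:
  assumes N: "N \<in> hyp3" and S: "S \<in> hyp3" and NS: "mink N S < -1"
    and 0: "axial_gram (- 1 / mink N S) (mink A A) (mink A N) (mink A S) (mink A N) (mink A S) = 0"
  shows "A \<in> span {N, S}"
proof -
  define x where "x = - mink N S"
  have x: "x > 1" and NS': "mink N S = - x" using NS by (auto simp: x_def)
  have x2: "x\<^sup>2 - 1 > 0" using x by (simp add: power2_eq_square less_1_mult)
  define a b where ab: "a = mink A N" "b = mink A S"
  define \<gamma> \<delta> where gd: "\<gamma> = (a - x * b) / (x\<^sup>2 - 1)" "\<delta> = (b - x * a) / (x\<^sup>2 - 1)"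
  define R where "R = A - (\<gamma> *\<^sub>R N + \<delta> *\<^sub>R S)"
  have g1: "- \<gamma> - x * \<delta> = a" "- x * \<gamma> - \<delta> = b"
    unfolding gd using x2 by (auto simp: divide_simps) (auto simp: power2_eq_square algebra_simps)
  have RN: "mink R N = 0" and RS: "mink R S = 0"
    using g1 hyp3_D[OF N] hyp3_D[OF S] NS' by (auto simp: R_def ab mink_commute[of S N] algebra_simps)
  have "mink R R = mink R A - \<gamma> * mink R N - \<delta> * mink R S"
    by (simp add: R_def)
  also have "\<dots> = mink A A - \<gamma> * a - \<delta> * b"
    by (simp only: RN RS) (simp add: R_def ab mink_commute)
  finally have RR: "mink R R = mink A A - \<gamma> * a - \<delta> * b" .
  have "(1 - 1 / x\<^sup>2) * mink R R = axial_gram (1 / x) (mink A A) a b a b"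
    unfolding RR by (rule axial_gram_projection[OF x gd])
  also have "\<dots> = 0" using 0 by (simp add: ab NS')
  finally have "mink R R = 0" using x x2 by simp
  then have "R = 0" using mink_pos_of_orthogonal[OF N RN] by force
  then have "A = \<gamma> *\<^sub>R N + \<delta> *\<^sub>R S" by (simp add: R_def)
  then show ?thesis by (metis insertI1 insertI2 span_add span_base span_scale)
qed

section \<open>Congruence from equal Gram matrices\<close>

text \<open>A linear Minkowski isometry could still exchange the two sheets of the hyperboloid.  One point \<open>p\<close>
  that stays on the upper sheet excludes this, because products of points on the same sheet are negative.\<close>

lemma mink_isometry_hyp3:
  assumes f: "linear f" and pres: "\<And>x y. mink (f x) (f y) = mink x y"
    and p: "p \<in> hyp3" "f p \<in> hyp3"
  shows "hyp_isometry f"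
proof -
  have inj: "inj f"
    unfolding linear_injective_0[OF f] by (metis mink_nondegenerate mink_linear_simps(9) pres)
  have surj: "surj f" using linear_inj_imp_surj[OF f inj] .
  have sheet: "x \<in> hyp3 \<or> - x \<in> hyp3" if "mink x x = -1" for x
  proof -
    have "fst x \<noteq> 0"
    proof
      assume "fst x = 0"
      then have "snd x \<bullet> snd x = -1" using that by (simp add: mink_def)
      then show False using inner_ge_zero[of "snd x"] by linarith
    qed
    then show ?thesis using that by (auto simp: hyp3_def)
  qed
  have into: "f x \<in> hyp3" if x: "x \<in> hyp3" for x
  proof (rule ccontr)
    assume "f x \<notin> hyp3"
    then have "- f x \<in> hyp3" using sheet[of "f x"] pres[of x x] hyp3_D[OF x] by auto
    then have "mink (- f x) (f p) \<le> -1" using p mink_hyp3_le by blast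
    moreover have "mink x p \<le> -1" using mink_hyp3_le[OF x p(1)] .
    ultimately show False by (simp add: pres)
  qed
  have onto: "y \<in> f ` hyp3" if y: "y \<in> hyp3" for y
  proof -
    obtain x where x: "y = f x" using surj by blast
    have "mink x x = -1" using y hyp3_D pres x by metis
    moreover have "- x \<notin> hyp3"
      using into[of "- x"] y by (auto simp: x linear_neg[OF f] hyp3_def)
    ultimately show ?thesis using sheet x by blast
  qed
  have "bij_betw f hyp3 hyp3"
    unfolding bij_betw_def using inj into onto by (auto intro: inj_on_subset)
  then show ?thesis by (simp add: hyp_isometry_def hdist_def pres)
qed

text \<open>Witt's extension argument: choose a basis among the \<open>p i\<close> and map it linearly to the corresponding
  \<open>q i\<close>.  This preserves the form, hence is bijective, and each remaining \<open>q i\<close> is determined by its products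
  with the image of the basis.\<close>

lemma isometry_of_equal_gram:
  assumes eq: "\<And>i j. i \<in> I \<Longrightarrow> j \<in> I \<Longrightarrow> mink (p i) (p j) = mink (q i) (q j)"
    and sp: "span (p ` I) = UNIV" and i0: "i0 \<in> I" "p i0 \<in> hyp3" "q i0 \<in> hyp3"
  shows "\<exists>f. hyp_isometry f \<and> (\<forall>i\<in>I. f (p i) = q i)"
proof -
  obtain B where B: "B \<subseteq> p ` I" "independent B" "p ` I \<subseteq> span B"
    using maximal_independent_subset by metis
  have spB: "span B = UNIV" using B sp by (metis span_minimal subspace_span top.extremum_uniqueI)
  define g where "g = q \<circ> inv_into I p"
  obtain f where f: "linear f" "\<And>b. b \<in> B \<Longrightarrow> f b = g b"
    using linear_independent_extend[OF B(2), of g] by metis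
  have idx: "\<exists>i\<in>I. b = p i \<and> f b = q i" if "b \<in> B" for b
    using that B(1) f(2)[OF that] unfolding g_def
    by (metis comp_apply f_inv_into_f inv_into_into subsetD)
  have linL: "linear (\<lambda>v. mink v a)" and linR: "linear (\<lambda>v. mink a v)" for a
    by (rule linearI, simp, simp)+
  have onB: "mink (f b) (f c) = mink b c" if "b \<in> B" "c \<in> B" for b c
    using idx[OF that(1)] idx[OF that(2)] eq by force
  have half: "mink (f b) (f v) = mink b v" if "b \<in> B" for b v
  proof (rule linear_eq_on[of "\<lambda>v. mink (f b) (f v)" "\<lambda>v. mink b v" v B])
    show "linear (\<lambda>v. mink (f b) (f v))"
      using linear_compose[OF f(1) linR[of "f b"]] by (simp add: o_def)
  qed (use linR spB onB that in auto)
  have pres: "mink (f v) (f w) = mink v w" for v w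
  proof (rule linear_eq_on[of "\<lambda>v. mink (f v) (f w)" "\<lambda>v. mink v w" v B])
    show "linear (\<lambda>v. mink (f v) (f w))"
      using linear_compose[OF f(1) linL[of "f w"]] by (simp add: o_def)
  qed (use linL spB half in auto)
  have inj: "inj f"
    unfolding linear_injective_0[OF f(1)] by (metis mink_nondegenerate mink_linear_simps(9) pres)
  have surj: "surj f" using linear_inj_imp_surj[OF f(1) inj] .
  have fp: "f (p i) = q i" if i: "i \<in> I" for i
  proof -
    have *: "mink (f (p i) - q i) (f v) = 0" for v
    proof (rule linear_eq_on[of "\<lambda>v. mink (f (p i) - q i) (f v)" "\<lambda>v. 0" v B])
      show "linear (\<lambda>v. mink (f (p i) - q i) (f v))"
        using linear_compose[OF f(1) linR[of "f (p i) - q i"]] by (simp add: o_def)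
      fix b assume "b \<in> B"
      then obtain j where "j \<in> I" "b = p j" "f b = q j" using idx by blast
      then show "mink (f (p i) - q i) (f b) = 0"
        using pres[of "p i" b] eq[OF i] by simp
    qed (use spB in \<open>auto simp: linear_zero\<close>)
    have "f (p i) - q i = 0"
      by (rule mink_nondegenerate) (metis * surj surjD)
    then show ?thesis by simp
  qed
  have "hyp_isometry f"
    by (rule mink_isometry_hyp3[OF f(1) pres i0(2)]) (simp add: fp i0)
  then show ?thesis using fp by blast
qed

section \<open>Elimination of square roots\<close>

definition square_roots :: "(nat \<Rightarrow> complex poly) \<Rightarrow> complex \<Rightarrow> (nat \<Rightarrow> complex) \<Rightarrow> bool" where
  "square_roots D x r \<longleftrightarrow> (\<forall>j. (r j)\<^sup>2 = poly (D j) x)"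

text \<open>The elements of the iterated quadratic extension of the polynomial ring by square roots of
  \<open>D 0, \<dots>, D (k - 1)\<close>, represented by their values at all points \<open>x\<close> and all choices \<open>r\<close> of the
  roots there.  Only values at genuine square roots count, which is what makes this
  class closed under products.\<close>

primrec multiquadratic ::
  "(nat \<Rightarrow> complex poly) \<Rightarrow> nat \<Rightarrow> (complex \<Rightarrow> (nat \<Rightarrow> complex) \<Rightarrow> complex) \<Rightarrow> bool" where
  "multiquadratic D 0 f \<longleftrightarrow> (\<exists>p. \<forall>x r. square_roots D x r \<longrightarrow> f x r = poly p x)"
| "multiquadratic D (Suc k) f \<longleftrightarrow> (\<exists>a b. multiquadratic D k a \<and> multiquadratic D k b \<and>
      (\<forall>x r. square_roots D x r \<longrightarrow> f x r = a x r + b x r * r k))"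

lemma multiquadratic_SucI:
  assumes "multiquadratic D k a" "multiquadratic D k b"
    and "\<And>x r. square_roots D x r \<Longrightarrow> f x r = a x r + b x r * r k"
  shows "multiquadratic D (Suc k) f"
  using assms by auto

lemma multiquadratic_SucE:
  assumes "multiquadratic D (Suc k) f"
  obtains a b where "multiquadratic D k a" "multiquadratic D k b"
    and "\<And>x r. square_roots D x r \<Longrightarrow> f x r = a x r + b x r * r k"
  using assms by auto

lemma multiquadratic_poly: "multiquadratic D k (\<lambda>x r. poly p x)"
proof (induction k arbitrary: p)
  case (Suc k)
  show ?case by (rule multiquadratic_SucI[OF Suc[of p] Suc[of 0]]) simp
qed auto

lemma multiquadratic_Suc:
  assumes "multiquadratic D k f"
  shows "multiquadratic D (Suc k) f"
  by (rule multiquadratic_SucI[OF assms multiquadratic_poly[of D k 0]]) simp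

lemma multiquadratic_root: "j < k \<Longrightarrow> multiquadratic D k (\<lambda>x r. r j)"
proof (induction k)
  case (Suc k)
  show ?case
  proof (cases "j = k")
    case True
    show ?thesis
      by (rule multiquadratic_SucI[OF multiquadratic_poly[of D k 0] multiquadratic_poly[of D k 1]])
        (simp add: True)
  next
    case False
    then show ?thesis using Suc by (intro multiquadratic_Suc) auto
  qed
qed simp

lemma multiquadratic_add:
  "multiquadratic D k f \<Longrightarrow> multiquadratic D k g \<Longrightarrow> multiquadratic D k (\<lambda>x r. f x r + g x r)"
proof (induction k arbitrary: f g)
  case 0
  then obtain p q where "\<forall>x r. square_roots D x r \<longrightarrow> f x r = poly p x"
    "\<forall>x r. square_roots D x r \<longrightarrow> g x r = poly q x" by auto
  then show ?case by (auto intro!: exI[of _ "p + q"])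
next
  case (Suc k)
  obtain a b where 1: "multiquadratic D k a" "multiquadratic D k b"
    "\<And>x r. square_roots D x r \<Longrightarrow> f x r = a x r + b x r * r k"
    using Suc.prems(1) by (rule multiquadratic_SucE) blast
  obtain c d where 2: "multiquadratic D k c" "multiquadratic D k d"
    "\<And>x r. square_roots D x r \<Longrightarrow> g x r = c x r + d x r * r k"
    using Suc.prems(2) by (rule multiquadratic_SucE) blast
  show ?case
    by (rule multiquadratic_SucI[OF Suc.IH[OF 1(1) 2(1)] Suc.IH[OF 1(2) 2(2)]])
      (simp add: 1(3) 2(3) algebra_simps)
qed

text \<open>In \<open>(a + b r) (c + d r)\<close> the square of the root \<open>r\<close> is replaced by the polynomial \<open>D k\<close>.\<close>

lemma multiquadratic_mult:
  "multiquadratic D k f \<Longrightarrow> multiquadratic D k g \<Longrightarrow> multiquadratic D k (\<lambda>x r. f x r * g x r)"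
proof (induction k arbitrary: f g)
  case 0
  then obtain p q where "\<forall>x r. square_roots D x r \<longrightarrow> f x r = poly p x"
    "\<forall>x r. square_roots D x r \<longrightarrow> g x r = poly q x" by auto
  then show ?case by (auto intro!: exI[of _ "p * q"])
next
  case (Suc k)
  obtain a b where 1: "multiquadratic D k a" "multiquadratic D k b"
    "\<And>x r. square_roots D x r \<Longrightarrow> f x r = a x r + b x r * r k"
    using Suc.prems(1) by (rule multiquadratic_SucE) blast
  obtain c d where 2: "multiquadratic D k c" "multiquadratic D k d"
    "\<And>x r. square_roots D x r \<Longrightarrow> g x r = c x r + d x r * r k"
    using Suc.prems(2) by (rule multiquadratic_SucE) blast
  let ?A = "\<lambda>x r. a x r * c x r + b x r * d x r * poly (D k) x"
  let ?B = "\<lambda>x r. a x r * d x r + b x r * c x r"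
  have "multiquadratic D k ?A" "multiquadratic D k ?B"
    using 1(1,2) 2(1,2) by (auto intro!: multiquadratic_add Suc.IH multiquadratic_poly)
  moreover have "f x r * g x r = ?A x r + ?B x r * r k" if "square_roots D x r" for x r
  proof -
    have "poly (D k) x = r k * r k" using that by (simp add: square_roots_def power2_eq_square)
    then show ?thesis using that 1(3) 2(3) by (simp add: algebra_simps)
  qed
  ultimately show ?case by (rule multiquadratic_SucI)
qed

lemma multiquadratic_prod:
  assumes "finite I" "\<And>i. i \<in> I \<Longrightarrow> multiquadratic D k (f i)"
  shows "multiquadratic D k (\<lambda>x r. \<Prod>i\<in>I. f i x r)"
  using assms
proof (induction I)
  case empty
  show ?case using multiquadratic_poly[of D k 1] by simp
next
  case (insert i I)
  then show ?case by (simp add: multiquadratic_mult)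
qed

lemma multiquadratic_cong:
  assumes "multiquadratic D k f" "square_roots D x r" "square_roots D x r'"
    and "\<And>j. j < k \<Longrightarrow> r j = r' j"
  shows "f x r = f x r'"
  using assms
proof (induction k arbitrary: f)
  case 0
  then show ?case by fastforce
next
  case (Suc k)
  obtain a b where 1: "multiquadratic D k a" "multiquadratic D k b"
    "\<And>x r. square_roots D x r \<Longrightarrow> f x r = a x r + b x r * r k"
    using Suc.prems(1) by (rule multiquadratic_SucE) blast
  have "a x r = a x r'" "b x r = b x r'"
    using Suc.IH[OF 1(1)] Suc.IH[OF 1(2)] Suc.prems by auto
  then show ?case using 1(3) Suc.prems by simp
qed

text \<open>The polynomial is the iterated norm: \<open>(a + b r) (a - b r) = a\<^sup>2 - b\<^sup>2 D\<close> does not involve the last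
  root any more.  A zero of the norm at \<open>x\<close> is a zero of one of the two factors, and the second factor
  is the first one at the opposite choice of the root.  This equivalence lets the relation
  be transported between different \<open>x\<close> without following the roots along a path.\<close>

lemma multiquadratic_norm:
  assumes "multiquadratic D k f"
  shows "\<exists>p. \<forall>x. (\<exists>r. square_roots D x r \<and> f x r = 0) \<longleftrightarrow> poly p x = 0"
  using assms
proof (induction k arbitrary: f)
  case 0
  then obtain p where p: "\<forall>x r. square_roots D x r \<longrightarrow> f x r = poly p x" by auto
  have "square_roots D x (\<lambda>j. csqrt (poly (D j) x))" for x by (simp add: square_roots_def)
  then have "(\<exists>r. square_roots D x r \<and> f x r = 0) \<longleftrightarrow> poly p x = 0" for x using p by metis
  then show ?case by blast
next
  case (Suc k)
  obtain a b where 1: "multiquadratic D k a" "multiquadratic D k b"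
    "\<And>x r. square_roots D x r \<Longrightarrow> f x r = a x r + b x r * r k"
    using Suc.prems by (rule multiquadratic_SucE) blast
  let ?g = "\<lambda>x r. a x r * a x r + poly (- 1) x * (b x r * b x r * poly (D k) x)"
  have "multiquadratic D k ?g"
    using 1(1,2) by (intro multiquadratic_add multiquadratic_mult multiquadratic_poly)
  then obtain p where p: "\<forall>x. (\<exists>r. square_roots D x r \<and> ?g x r = 0) \<longleftrightarrow> poly p x = 0"
    using Suc.IH[of ?g] by blast
  note abf = 1(3)
  have fact: "?g x r = (a x r + b x r * r k) * (a x r - b x r * r k)" if "square_roots D x r" for x r
  proof -
    have "poly (D k) x = r k * r k" using that by (simp add: square_roots_def power2_eq_square)
    then show ?thesis by (simp add: algebra_simps)
  qed
  have "(\<exists>r. square_roots D x r \<and> f x r = 0) \<longleftrightarrow> (\<exists>r. square_roots D x r \<and> ?g x r = 0)" for x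
  proof
    assume "\<exists>r. square_roots D x r \<and> f x r = 0"
    then show "\<exists>r. square_roots D x r \<and> ?g x r = 0" using 1(3) fact by (metis mult_zero_left)
  next
    assume "\<exists>r. square_roots D x r \<and> ?g x r = 0"
    then obtain r where r: "square_roots D x r" "?g x r = 0" by blast
    then consider "a x r + b x r * r k = 0" | "a x r - b x r * r k = 0"
      using fact[OF r(1)] by (metis mult_eq_0_iff)
    then show "\<exists>r. square_roots D x r \<and> f x r = 0"
    proof cases
      case 1
      then show ?thesis using r(1) abf by metis
    next
      case 2
      let ?r = "r(k := - r k)"
      have r': "square_roots D x ?r" using r(1) by (simp add: square_roots_def)
      have "a x ?r = a x r" "b x ?r = b x r"
        using multiquadratic_cong[OF 1(1) r' r(1)] multiquadratic_cong[OF 1(2) r' r(1)] by auto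
      then have "f x ?r = 0" using 1(3) r' 2 by simp
      then show ?thesis using r' by blast
    qed
  qed
  then show ?case using p by auto
qed

section \<open>The closing relation of the equator\<close>

definition axial_poly :: "real \<Rightarrow> real \<Rightarrow> real \<Rightarrow> real \<Rightarrow> real \<Rightarrow> complex poly" where
  "axial_poly m a b a' b' =
     [: of_real m, of_real (a * b' + b * a'), of_real (- m - (a * a' + b * b')) :]"

lemma poly_axial_poly: "poly (axial_poly m a b a' b') (of_real y) = of_real (axial_gram y m a b a' b')"
  by (simp add: axial_poly_def axial_gram_def power2_eq_square algebra_simps)

lemma square_of_imaginary_part:
  "(\<i> * of_real (Im w))\<^sup>2 = (of_real (Re w))\<^sup>2 - w * cnj w"
  by (simp add: complex_eq_iff power2_eq_square)

text \<open>The hypothesis describes, for infinitely many \<open>y\<close>, the projections of the vertices of closed polygons with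
  fixed edges; \<open>nx\<close> is the cyclic successor.  That \<open>nx\<close> is a bijection makes the product of the
  \<open>cnj (z j) * z (nx j)\<close> telescope to the product of the squared moduli.\<close>

lemma closing_relation_at_zero:
  fixes I :: "nat set" and nx :: "nat \<Rightarrow> nat" and Y :: "real set"
  assumes I: "finite I" and nx: "bij_betw nx I I" and Y: "infinite Y"
    and z: "\<And>y. y \<in> Y \<Longrightarrow> \<exists>z :: nat \<Rightarrow> complex. \<forall>j\<in>I.
        Re (cnj (z j) * z j) = axial_gram y (- 1) (a j) (b j) (a j) (b j) \<and>
        Re (cnj (z j) * z (nx j)) = axial_gram y (m j) (a j) (b j) (a (nx j)) (b (nx j))"
  obtains r where "\<And>j. j \<in> I \<Longrightarrow> (r j)\<^sup>2 = complex_of_real ((m j)\<^sup>2 - 1)"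
    and "(\<Prod>j\<in>I. of_real (m j) + r j) = (\<Prod>j\<in>I. - 1)"
proof -
  define F where "F j = axial_poly (m j) (a j) (b j) (a (nx j)) (b (nx j))" for j
  define G where "G j = axial_poly (- 1) (a j) (b j) (a j) (b j)" for j
  \<comment> \<open>The squared modulus of \<open>cnj (z j) * z (nx j)\<close> is \<open>G j * G (nx j)\<close>, its real part is \<open>F j\<close>, and \<open>D j\<close>
    is the square of \<open>\<i>\<close> times its imaginary part.  Outside \<open>I\<close>, the value \<open>0\<close> provides a square
    root that is the same for all \<open>y\<close>.\<close>
  define D where "D j = (if j \<in> I then (F j)\<^sup>2 - G j * G (nx j) else 0)" for j
  define f where "f x r = (\<Prod>j\<in>I. poly (F j) x + r j) + poly (- (\<Prod>j\<in>I. G j)) x" for x and r :: "nat \<Rightarrow> complex"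
  obtain k where k: "\<And>j. j \<in> I \<Longrightarrow> j < k" using I finite_nat_set_iff_bounded by auto
  have "multiquadratic D k f"
    unfolding f_def
    by (intro multiquadratic_add multiquadratic_prod multiquadratic_poly multiquadratic_root I k)
  then obtain q where q: "\<And>x. (\<exists>r. square_roots D x r \<and> f x r = 0) \<longleftrightarrow> poly q x = 0"
    using multiquadratic_norm by blast
  have root: "poly q (of_real y) = 0" if y: "y \<in> Y" for y
  proof -
    obtain z :: "nat \<Rightarrow> complex" where z: "\<And>j. j \<in> I \<Longrightarrow> Re (cnj (z j) * z j) = axial_gram y (- 1) (a j) (b j) (a j) (b j)"
        "\<And>j. j \<in> I \<Longrightarrow> Re (cnj (z j) * z (nx j)) = axial_gram y (m j) (a j) (b j) (a (nx j)) (b (nx j))"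
      using z[OF y] by blast
    define r where "r j = (if j \<in> I then \<i> * of_real (Im (cnj (z j) * z (nx j))) else 0)" for j
    have G: "poly (G j) (of_real y) = cnj (z j) * z j" if "j \<in> I" for j
      using z(1)[OF that] by (simp add: G_def poly_axial_poly complex_eq_iff)
    have F: "poly (F j) (of_real y) + r j = cnj (z j) * z (nx j)" if "j \<in> I" for j
      using z(2)[OF that] that by (simp add: F_def poly_axial_poly complex_eq_iff r_def)
    have nxI: "nx j \<in> I" if "j \<in> I" for j using nx that bij_betwE by blast
    have "(r j)\<^sup>2 = poly (D j) (of_real y)" for j
    proof (cases "j \<in> I")
      case True
      let ?w = "cnj (z j) * z (nx j)"
      have "(r j)\<^sup>2 = (of_real (Re ?w))\<^sup>2 - ?w * cnj ?w"
        using True by (simp only: r_def if_True square_of_imaginary_part)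
      also have "of_real (Re ?w) = poly (F j) (of_real y)"
        using z(2)[OF True] by (simp add: F_def poly_axial_poly)
      also have "?w * cnj ?w = poly (G j) (of_real y) * poly (G (nx j)) (of_real y)"
        using G[OF True] G[OF nxI[OF True]] by simp
      finally show ?thesis using True by (simp add: D_def)
    qed (simp add: D_def r_def)
    then have "square_roots D (of_real y) r" by (simp add: square_roots_def)
    moreover have "f (of_real y) r = 0"
    proof -
      have "(\<Prod>j\<in>I. poly (F j) (of_real y) + r j) = (\<Prod>j\<in>I. cnj (z j) * z (nx j))"
        by (intro prod.cong refl F)
      also have "\<dots> = (\<Prod>j\<in>I. cnj (z j)) * (\<Prod>j\<in>I. z j)"
        by (simp only: prod.distrib prod.reindex_bij_betw[OF nx])
      also have "\<dots> = (\<Prod>j\<in>I. poly (G j) (of_real y))"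
        by (simp only: prod.distrib[symmetric]) (intro prod.cong refl G[symmetric])
      finally show ?thesis by (simp add: f_def poly_prod)
    qed
    ultimately show ?thesis using q by blast
  qed
  have "q = 0"
  proof (rule ccontr)
    assume "q \<noteq> 0"
    then have "finite {x. poly q x = 0}" by (rule poly_roots_finite)
    moreover have "complex_of_real ` Y \<subseteq> {x. poly q x = 0}" using root by auto
    ultimately have "finite (complex_of_real ` Y)" by (rule finite_subset[rotated])
    then show False using Y finite_imageD[of complex_of_real Y] by (simp add: inj_on_def)
  qed
  then obtain r where r: "square_roots D 0 r" "f 0 r = 0" using q[of 0] by auto
  show thesis
  proof (rule that[of r])
    show "(r j)\<^sup>2 = complex_of_real ((m j)\<^sup>2 - 1)" if "j \<in> I" for j
      using r(1) that by (simp add: square_roots_def D_def F_def G_def axial_poly_def)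
    show "(\<Prod>j\<in>I. of_real (m j) + r j) = (\<Prod>j\<in>I. - 1)"
      using r(2) by (simp add: f_def F_def G_def poly_prod axial_poly_def)
  qed
qed

text \<open>The roots are \<open>\<plusminus> sinh (e j)\<close>, so every factor on the left is \<open>- exp (\<plusminus> e j)\<close>.\<close>

lemma signs_of_closing_relation:
  fixes e :: "nat \<Rightarrow> real"
  assumes I: "finite I" and r: "\<And>j. j \<in> I \<Longrightarrow> (r j)\<^sup>2 = complex_of_real ((cosh (e j))\<^sup>2 - 1)"
    and prod: "(\<Prod>j\<in>I. - of_real (cosh (e j)) + r j) = (\<Prod>j\<in>I. - 1)"
  obtains \<sigma> :: "nat \<Rightarrow> real" where "\<And>j. \<sigma> j \<in> {1, - 1}" "(\<Sum>j\<in>I. \<sigma> j * e j) = 0"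
proof -
  define \<sigma> :: "nat \<Rightarrow> real" where "\<sigma> j = (if r j = of_real (sinh (e j)) then 1 else - 1)" for j
  have *: "- of_real (cosh (e j)) + r j = - complex_of_real (exp (- (\<sigma> j * e j)))" if j: "j \<in> I" for j
  proof -
    have "(r j)\<^sup>2 = (of_real (sinh (e j)))\<^sup>2"
      using r[OF j] cosh_square_eq[of "e j"] by simp
    then have "r j = of_real (sinh (e j)) \<or> r j = - of_real (sinh (e j))"
      by (simp add: power2_eq_iff)
    then have "r j = of_real (\<sigma> j * sinh (e j))" by (auto simp: \<sigma>_def)
    moreover have "exp (- (\<sigma> j * e j)) = cosh (e j) - \<sigma> j * sinh (e j)"
      using sinh_plus_cosh[of "e j"] cosh_minus_sinh[of "e j"] by (auto simp: \<sigma>_def)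
    ultimately show ?thesis by simp
  qed
  have "(\<Prod>j\<in>I. - 1) = (\<Prod>j\<in>I. - complex_of_real (exp (- (\<sigma> j * e j))))"
    using prod by (simp only: * cong: prod.cong)
  also have "\<dots> = (\<Prod>j\<in>I. - 1) * (\<Prod>j\<in>I. complex_of_real (exp (- (\<sigma> j * e j))))"
    by (simp only: prod.distrib[symmetric] mult_minus1)
  also have "(\<Prod>j\<in>I. complex_of_real (exp (- (\<sigma> j * e j)))) = of_real (exp (\<Sum>j\<in>I. - (\<sigma> j * e j)))"
    by (simp only: exp_sum[OF I] of_real_prod)
  finally have "complex_of_real (exp (\<Sum>j\<in>I. - (\<sigma> j * e j))) = 1" by simp
  then have "exp (\<Sum>j\<in>I. - (\<sigma> j * e j)) = 1" by (simp only: of_real_eq_1_iff)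
  then have "(\<Sum>j\<in>I. \<sigma> j * e j) = 0" by (simp add: sum_negf)
  then show thesis by (intro that[of \<sigma>]) (auto simp: \<sigma>_def)
qed

section \<open>Rigidity for a constant distance of the poles\<close>

lemma continuous_finite_values_constant:
  fixes g :: "real \<Rightarrow> real"
  assumes "continuous_on {0..1} g" "finite (g ` {0..1})" "t \<in> {0..1}"
  shows "g t = g 0"
proof -
  have "connected (g ` {0..1})" using assms(1) by (intro connected_continuous_image) auto
  then obtain c where "g ` {0..1} = {c}" using assms(2) connected_finite_iff_sing[of "g ` {0..1}"] by auto
  then show ?thesis using assms(3) by (metis atLeastAtMost_iff imageI order_refl singletonD zero_le_one)
qed

text \<open>The real part of \<open>cnj (z j) * z (j + 1)\<close> is given and its modulus is known, which leaves two
  conjugate values.  The other products are obtained from consecutive ones by multiplication and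
  division by the nonzero \<open>g j\<close>.\<close>

lemma finite_values_of_chain:
  fixes z :: "real \<Rightarrow> nat \<Rightarrow> complex"
  assumes g: "\<And>t j. t \<in> T \<Longrightarrow> j \<in> {1..V} \<Longrightarrow> Re (cnj (z t j) * z t j) = g j"
    and g0: "\<And>j. j \<in> {1..V} \<Longrightarrow> g j \<noteq> 0"
    and c: "\<And>t j. t \<in> T \<Longrightarrow> j \<in> {1..<V} \<Longrightarrow> Re (cnj (z t j) * z t (Suc j)) = c j"
    and jk: "j \<in> {1..V}" "k \<in> {1..V}"
  shows "finite ((\<lambda>t. cnj (z t j) * z t k) ` T)"
proof -
  have zz: "cnj (z t j) * z t j = of_real (g j)" if "t \<in> T" "j \<in> {1..V}" for t j
    using g[OF that] by (simp add: complex_eq_iff)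
  have step: "finite ((\<lambda>t. cnj (z t j) * z t (Suc j)) ` T)" if j: "j \<in> {1..<V}" for j
  proof -
    define s where "s = sqrt (g j * g (Suc j) - (c j)\<^sup>2)"
    have "cnj (z t j) * z t (Suc j) \<in> {Complex (c j) s, Complex (c j) (- s)}" if t: "t \<in> T" for t
    proof -
      let ?w = "cnj (z t j) * z t (Suc j)"
      have "(cmod ?w)\<^sup>2 = (cmod (z t j))\<^sup>2 * (cmod (z t (Suc j)))\<^sup>2"
        by (simp add: norm_mult power_mult_distrib)
      also have "\<dots> = g j * g (Suc j)"
        using g[OF t, of j] g[OF t, of "Suc j"] j by (simp only: cmod_power2) (simp add: power2_eq_square)
      finally have "(Im ?w)\<^sup>2 = g j * g (Suc j) - (c j)\<^sup>2"
        using c[OF t j] by (simp add: cmod_power2)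
      then have "\<bar>Im ?w\<bar> = s" unfolding s_def by (metis real_sqrt_abs)
      then have "Im ?w = s \<or> Im ?w = - s" by linarith
      then show ?thesis using c[OF t j] by (metis complex.collapse insertCI)
    qed
    then have "(\<lambda>t. cnj (z t j) * z t (Suc j)) ` T \<subseteq> {Complex (c j) s, Complex (c j) (- s)}" by blast
    then show ?thesis using finite_subset by blast
  qed
  have one: "finite ((\<lambda>t. cnj (z t 1) * z t k) ` T)" if "1 \<le> k" "k \<le> V" for k
    using that
  proof (induction k rule: dec_induct)
    case base
    have "(\<lambda>t. cnj (z t 1) * z t 1) ` T \<subseteq> {of_real (g 1)}" using zz base by auto
    then show ?case using finite_subset by blast
  next
    case (step k)
    let ?A = "(\<lambda>t. cnj (z t 1) * z t k) ` T" and ?B = "(\<lambda>t. cnj (z t k) * z t (Suc k)) ` T"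
    have k: "k \<in> {1..V}" "k \<in> {1..<V}" using step by auto
    have "cnj (z t 1) * z t (Suc k) = (cnj (z t 1) * z t k) * (cnj (z t k) * z t (Suc k)) / of_real (g k)"
      if "t \<in> T" for t
    proof -
      have "(cnj (z t 1) * z t k) * (cnj (z t k) * z t (Suc k))
          = (cnj (z t 1) * z t (Suc k)) * (cnj (z t k) * z t k)" by simp
      also have "\<dots> = (cnj (z t 1) * z t (Suc k)) * of_real (g k)" by (simp only: zz[OF that k(1)])
      finally show ?thesis using g0[OF k(1)] by (simp only: nonzero_eq_divide_eq of_real_eq_0_iff simp_thms)
    qed
    then have "(\<lambda>t. cnj (z t 1) * z t (Suc k)) ` T \<subseteq> (\<lambda>(u, v). u * v / of_real (g k)) ` (?A \<times> ?B)"
      by (force simp: image_iff)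
    moreover have "finite (?A \<times> ?B)" using step \<open>\<And>j. j \<in> {1..<V} \<Longrightarrow> finite _\<close>[OF k(2)] by auto
    ultimately show ?case using finite_subset by blast
  qed
  let ?A = "(\<lambda>t. cnj (z t 1) * z t j) ` T" and ?B = "(\<lambda>t. cnj (z t 1) * z t k) ` T"
  have 1: "1 \<in> {1..V}" using jk by auto
  have "cnj (z t j) * z t k = cnj (cnj (z t 1) * z t j) * (cnj (z t 1) * z t k) / of_real (g 1)"
    if "t \<in> T" for t
  proof -
    have "cnj (cnj (z t 1) * z t j) * (cnj (z t 1) * z t k)
        = (cnj (z t j) * z t k) * (cnj (z t 1) * z t 1)" by simp
    also have "\<dots> = (cnj (z t j) * z t k) * of_real (g 1)" by (simp only: zz[OF that 1])
    finally show ?thesis using g0[OF 1] by (simp only: nonzero_eq_divide_eq of_real_eq_0_iff simp_thms)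
  qed
  then have "(\<lambda>t. cnj (z t j) * z t k) ` T \<subseteq> (\<lambda>(u, v). cnj u * v / of_real (g 1)) ` (?A \<times> ?B)"
    by (force simp: image_iff)
  moreover have "finite (?A \<times> ?B)" using one jk by auto
  ultimately show ?thesis using finite_subset by blast
qed

lemma equator_next_bij: "bij_betw (equator_next V) {1..V} {1..V}"
  by (rule bij_betw_byWitness[where f' = "\<lambda>j. if j = 1 then V else j - 1"])
    (auto simp: equator_next_def)

text \<open>The vertices \<open>p t v\<close> of a flexing suspension at time \<open>t\<close>, with the constancy of the edge lengths
  expressed by \<open>mink\<close> and the nondegeneracy at time \<open>0\<close> by linear span.\<close>

locale suspension_motion =
  fixes V :: nat and p :: "real \<Rightarrow> nat \<Rightarrow> minkowski"
  assumes V: "1 \<le> V"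
    and on_hyp3: "\<And>t v. t \<in> {0..1} \<Longrightarrow> v \<le> V + 1 \<Longrightarrow> p t v \<in> hyp3"
    and continuous_vertex: "\<And>v. v \<le> V + 1 \<Longrightarrow> continuous_on {0..1} (\<lambda>t. p t v)"
    and north: "\<And>t j. t \<in> {0..1} \<Longrightarrow> j \<in> {1..V} \<Longrightarrow> mink (p t j) (p t 0) = mink (p 0 j) (p 0 0)"
    and south: "\<And>t j. t \<in> {0..1} \<Longrightarrow> j \<in> {1..V} \<Longrightarrow>
      mink (p t j) (p t (V + 1)) = mink (p 0 j) (p 0 (V + 1))"
    and equator: "\<And>t j. t \<in> {0..1} \<Longrightarrow> j \<in> {1..V} \<Longrightarrow>
      mink (p t j) (p t (equator_next V j)) = mink (p 0 j) (p 0 (equator_next V j))"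
    and spanning: "\<And>j. j \<in> {1..V} \<Longrightarrow>
      span {p 0 0, p 0 (V + 1), p 0 j, p 0 (equator_next V j)} = UNIV"
begin

definition pole_product :: "real \<Rightarrow> real" where "pole_product t = mink (p t 0) (p t (V + 1))"

lemma continuous_mink:
  assumes "v \<le> V + 1" "w \<le> V + 1"
  shows "continuous_on {0..1} (\<lambda>t. mink (p t v) (p t w))"
  unfolding mink_def by (intro continuous_intros continuous_vertex assms)

lemma next_in: "j \<in> {1..V} \<Longrightarrow> equator_next V j \<in> {1..V}"
  by (auto simp: equator_next_def)

lemma span_three_ne_UNIV: "span {u, v, w} \<noteq> (UNIV :: minkowski set)"
proof
  assume "span {u, v, w} = (UNIV :: minkowski set)"
  then have "dim (span {u, v, w}) = 4" by simp
  moreover have "dim {u, v, w} \<le> card {u, v, w}" by (rule dim_le_card) (auto simp: span_superset)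
  moreover have "card {u, v, w} \<le> 3" by (auto simp: card_insert_if)
  ultimately show False by (simp add: dim_span)
qed

lemma pole_product_0: "pole_product 0 < - 1"
proof (rule ccontr)
  assume "\<not> pole_product 0 < - 1"
  moreover have hyp: "p 0 0 \<in> hyp3" "p 0 (V + 1) \<in> hyp3" using on_hyp3 by auto
  ultimately have "pole_product 0 = - 1" using mink_hyp3_le[OF hyp] by (simp add: pole_product_def)
  then have "p 0 0 = p 0 (V + 1)" using mink_hyp3_eq[OF hyp] by (simp add: pole_product_def)
  then show False using spanning[of 1] V span_three_ne_UNIV by auto
qed

text \<open>Of the arguments of \<open>axial_gram\<close>, only the first and the product of the two vertices can depend on
  time: the products with the poles are edge lengths.\<close>

lemma projection:
  assumes t: "t \<in> {0..1}" and ax: "pole_product t < - 1"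
  shows "\<exists>z. (\<forall>j\<in>{1..V}. \<forall>k\<in>{1..V}. Re (cnj (z j) * z k) = axial_gram (- 1 / pole_product t)
      (mink (p t j) (p t k)) (mink (p 0 j) (p 0 0)) (mink (p 0 j) (p 0 (V + 1)))
      (mink (p 0 k) (p 0 0)) (mink (p 0 k) (p 0 (V + 1))))"
proof -
  have hyp: "p t 0 \<in> hyp3" "p t (V + 1) \<in> hyp3" using on_hyp3 t by auto
  obtain z :: "minkowski \<Rightarrow> complex" where z: "\<And>A B. Re (cnj (z A) * z B) = axial_gram (- 1 / pole_product t) (mink A B)
      (mink A (p t 0)) (mink A (p t (V + 1))) (mink B (p t 0)) (mink B (p t (V + 1)))"
    using axial_projection[OF hyp] ax unfolding pole_product_def by blast
  show ?thesis
    by (intro exI[of _ "\<lambda>j. z (p t j)"] ballI) (simp only: z north[OF t] south[OF t])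
qed

text \<open>No equator vertex lies on the line through the poles at time \<open>0\<close>, by nondegeneracy.\<close>

lemma axial_gram_nonzero:
  assumes j: "j \<in> {1..V}"
  shows "axial_gram (- 1 / pole_product 0) (- 1) (mink (p 0 j) (p 0 0)) (mink (p 0 j) (p 0 (V + 1)))
      (mink (p 0 j) (p 0 0)) (mink (p 0 j) (p 0 (V + 1))) \<noteq> 0"
proof
  assume "axial_gram (- 1 / pole_product 0) (- 1) (mink (p 0 j) (p 0 0)) (mink (p 0 j) (p 0 (V + 1)))
      (mink (p 0 j) (p 0 0)) (mink (p 0 j) (p 0 (V + 1))) = 0"
  moreover have hyp: "p 0 0 \<in> hyp3" "p 0 (V + 1) \<in> hyp3" "p 0 j \<in> hyp3" using on_hyp3 j by auto
  ultimately have "p 0 j \<in> span {p 0 0, p 0 (V + 1)}"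
    using pole_product_0 hyp3_D(1)[OF hyp(3)] unfolding pole_product_def
    by (intro axial_gram_eq_0_imp_span) auto
  then have "p 0 j \<in> span {p 0 0, p 0 (V + 1), p 0 (equator_next V j)}"
    by (rule subsetD[OF span_mono, rotated]) auto
  then have "span (insert (p 0 j) {p 0 0, p 0 (V + 1), p 0 (equator_next V j)})
      = span {p 0 0, p 0 (V + 1), p 0 (equator_next V j)}"
    by (rule span_redundant)
  moreover have "insert (p 0 j) {p 0 0, p 0 (V + 1), p 0 (equator_next V j)}
      = {p 0 0, p 0 (V + 1), p 0 j, p 0 (equator_next V j)}" by auto
  ultimately show False using spanning[OF j] span_three_ne_UNIV by metis
qed

text \<open>When the first argument of \<open>axial_gram\<close> is fixed too, each product of two equator vertices is an affine
  function of \<open>Re (cnj (z j) * z k)\<close>, which takes finitely many values; being continuous in time, it is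
  constant.\<close>

lemma gram_constant_if_pole_product_constant:
  assumes const: "\<And>t. t \<in> {0..1} \<Longrightarrow> pole_product t = pole_product 0"
    and t: "t \<in> {0..1}" and v: "v \<le> V + 1" and w: "w \<le> V + 1"
  shows "mink (p t v) (p t w) = mink (p 0 v) (p 0 w)"
proof -
  define a where "a j = mink (p 0 j) (p 0 0)" for j
  define b where "b j = mink (p 0 j) (p 0 (V + 1))" for j
  define y where "y = - 1 / pole_product 0"
  have "\<bar>y\<bar> < 1" using pole_product_0 by (simp add: y_def abs_if divide_simps)
  then have y2: "1 - y\<^sup>2 \<noteq> 0" by (simp add: abs_square_less_1[symmetric])
  have "\<forall>t\<in>{0..1}. \<exists>z. (\<forall>j\<in>{1..V}. \<forall>k\<in>{1..V}. Re (cnj (z j) * z k) =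
      axial_gram y (mink (p t j) (p t k)) (a j) (b j) (a k) (b k))"
  proof
    fix t :: real assume t: "t \<in> {0..1}"
    then have "pole_product t < - 1" using pole_product_0 const[OF t] by simp
    from projection[OF t this] show "\<exists>z. (\<forall>j\<in>{1..V}. \<forall>k\<in>{1..V}. Re (cnj (z j) * z k) =
      axial_gram y (mink (p t j) (p t k)) (a j) (b j) (a k) (b k))"
      by (simp only: const[OF t] y_def a_def b_def)
  qed
  then obtain z :: "real \<Rightarrow> nat \<Rightarrow> complex" where z: "\<And>t j k. t \<in> {0..1} \<Longrightarrow> j \<in> {1..V} \<Longrightarrow> k \<in> {1..V} \<Longrightarrow>
      Re (cnj (z t j) * z t k) = axial_gram y (mink (p t j) (p t k)) (a j) (b j) (a k) (b k)"
    by metis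
  have self: "mink (p t v) (p t v) = - 1" if "t \<in> {0..1}" "v \<le> V + 1" for t v
    using on_hyp3[OF that] hyp3_D by blast
  have eq: "mink (p t j) (p t k) = mink (p 0 j) (p 0 k)" if j: "j \<in> {1..V}" and k: "k \<in> {1..V}" for j k
  proof -
    have fin: "finite ((\<lambda>t. cnj (z t j) * z t k) ` {0..1})"
    proof (rule finite_values_of_chain[OF _ _ _ j k])
      show "Re (cnj (z t j) * z t j) = axial_gram y (- 1) (a j) (b j) (a j) (b j)"
        if "t \<in> {0..1}" "j \<in> {1..V}" for t j
        using z[OF that that(2)] self[OF that(1), of j] that(2) by simp
      show "axial_gram y (- 1) (a j) (b j) (a j) (b j) \<noteq> 0" if "j \<in> {1..V}" for j
        using axial_gram_nonzero[OF that] by (simp add: y_def a_def b_def)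
      show "Re (cnj (z t j) * z t (Suc j)) =
          axial_gram y (mink (p 0 j) (p 0 (Suc j))) (a j) (b j) (a (Suc j)) (b (Suc j))"
        if "t \<in> {0..1}" "j \<in> {1..<V}" for t j
        using z[OF that(1), of j "Suc j"] equator[OF that(1), of j] that(2) by (simp add: equator_next_def)
    qed
    \<comment> \<open>\<open>h\<close> solves \<open>Re c = axial_gram y m (a j) (b j) (a k) (b k)\<close> for \<open>m\<close>.\<close>
    define h where "h c = (Re c - y * (a j * b k + b j * a k) + y\<^sup>2 * (a j * a k + b j * b k)) / (1 - y\<^sup>2)" for c
    have "mink (p t j) (p t k) = h (cnj (z t j) * z t k)" if "t \<in> {0..1}" for t
      unfolding h_def z[OF that j k] axial_gram_def using y2 by simp
    then have "(\<lambda>t. mink (p t j) (p t k)) ` {0..1} = h ` (\<lambda>t. cnj (z t j) * z t k) ` {0..1}"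
      unfolding image_image by (rule image_cong[OF refl])
    then have "finite ((\<lambda>t. mink (p t j) (p t k)) ` {0..1})"
      by (simp only: finite_imageI[OF fin])
    moreover have "continuous_on {0..1} (\<lambda>t. mink (p t j) (p t k))"
      using j k by (intro continuous_mink) auto
    ultimately show ?thesis using continuous_finite_values_constant t by blast
  qed
  define n where "n = V + 1"
  define E where "E v w \<longleftrightarrow> mink (p t v) (p t w) = mink (p 0 v) (p 0 w)" for v w
  have pole: "v = 0 \<or> v = n \<or> v \<in> {1..V}" if "v \<le> V + 1" for v
    using that by (auto simp: n_def)
  have sym: "E w v" if "E v w" for v w
    using that by (simp only: E_def mink_commute)
  have poles: "E 0 n" "E 0 0" "E n n"
    using const[OF t] self t by (simp_all add: pole_product_def E_def n_def)
  have mixed: "E j 0" "E j n" if "j \<in> {1..V}" for j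
    using north[OF t that] south[OF t that] by (simp_all only: E_def n_def)
  have equatorial: "E j k" if "j \<in> {1..V}" "k \<in> {1..V}" for j k
    using eq[OF that] by (simp only: E_def)
  have "E v w"
    using pole[OF v] pole[OF w]
    by (elim disjE) (auto intro: poles mixed equatorial poles(1)[THEN sym] mixed[THEN sym]
        simp del: atLeastAtMost_iff)
  then show ?thesis by (simp only: E_def)
qed

lemma rigid_if_pole_product_constant:
  assumes const: "\<And>t. t \<in> {0..1} \<Longrightarrow> pole_product t = pole_product 0" and t: "t \<in> {0..1}"
  shows "\<exists>f. hyp_isometry f \<and> (\<forall>v\<le>V + 1. p t v = f (p 0 v))"
proof -
  have "span (p 0 ` {..V + 1}) = UNIV"
  proof -
    have "{p 0 0, p 0 (V + 1), p 0 1, p 0 (equator_next V 1)} \<subseteq> p 0 ` {..V + 1}"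
      using V next_in[of 1] by auto
    from span_mono[OF this] show ?thesis using spanning[of 1] V by (simp add: top.extremum_unique)
  qed
  moreover have "mink (p 0 v) (p 0 w) = mink (p t v) (p t w)" if "v \<in> {..V + 1}" "w \<in> {..V + 1}" for v w
    using gram_constant_if_pole_product_constant[OF const t] that by simp
  moreover have "p 0 0 \<in> hyp3" "p t 0 \<in> hyp3" using on_hyp3 t by auto
  ultimately have "\<exists>f. hyp_isometry f \<and> (\<forall>v\<in>{..V + 1}. f (p 0 v) = p t v)"
    by (intro isometry_of_equal_gram[of "{..V + 1}" "p 0" "p t" 0]) simp_all
  then obtain f where "hyp_isometry f" "\<forall>v\<in>{..V + 1}. f (p 0 v) = p t v" by (elim exE conjE)
  then show ?thesis by (intro exI[of _ f]) simp
qed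

text \<open>By connectedness, a nonconstant \<open>pole_product\<close> takes infinitely many values.  The value \<open>- 1\<close>, at which the poles
  coincide and there is no projection along the axis, is discarded.\<close>

lemma signed_sum_if_pole_product_varies:
  assumes "s \<in> {0..1}" "pole_product s \<noteq> pole_product 0"
  obtains \<sigma> :: "nat \<Rightarrow> real" where "\<And>j. \<sigma> j \<in> {1, - 1}"
    "(\<Sum>j = 1..V. \<sigma> j * hdist (p 0 j) (p 0 (equator_next V j))) = 0"
proof -
  define Y where "Y = (\<lambda>x. - 1 / x) ` (pole_product ` {0..1} - {- 1})"
  have le: "pole_product t \<le> - 1" if "t \<in> {0..1}" for t
    unfolding pole_product_def using on_hyp3 that by (intro mink_hyp3_le) auto
  have "connected (pole_product ` {0..1})"
    unfolding pole_product_def[abs_def] by (intro connected_continuous_image continuous_mink) auto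
  moreover have "\<not> (\<exists>c. pole_product ` {0..1} = {c})"
  proof
    assume "\<exists>c. pole_product ` {0..1} = {c}"
    then obtain c where c: "pole_product ` {0..1} = {c}" by blast
    have "pole_product s \<in> pole_product ` {0..1}" "pole_product 0 \<in> pole_product ` {0..1}" using assms(1) by auto
    then show False using assms(2) unfolding c by simp
  qed
  ultimately have "infinite (pole_product ` {0..1})"
    using connected_finite_iff_sing[of "pole_product ` {0..1}"] by auto
  then have "infinite (pole_product ` {0..1} - {- 1})" by simp
  moreover have "inj_on (\<lambda>x. - 1 / x) (pole_product ` {0..1} - {- 1})" by (auto simp: inj_on_def)
  ultimately have Y: "infinite Y" unfolding Y_def using finite_imageD by blast
  let ?m = "\<lambda>j. mink (p 0 j) (p 0 (equator_next V j))"
  let ?e = "\<lambda>j. hdist (p 0 j) (p 0 (equator_next V j))"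
  obtain r where r: "\<And>j. j \<in> {1..V} \<Longrightarrow> (r j)\<^sup>2 = complex_of_real ((?m j)\<^sup>2 - 1)"
    and pr: "(\<Prod>j\<in>{1..V}. of_real (?m j) + r j) = (\<Prod>j\<in>{1..V}. - 1)"
  proof (rule closing_relation_at_zero[OF _ equator_next_bij[of V] Y,
        of "\<lambda>j. mink (p 0 j) (p 0 0)" "\<lambda>j. mink (p 0 j) (p 0 (V + 1))" ?m])
    fix y assume "y \<in> Y"
    then obtain t where t: "t \<in> {0..1}" "pole_product t \<noteq> - 1" "y = - 1 / pole_product t"
      unfolding Y_def by blast
    then have "pole_product t < - 1" using le[OF t(1)] by simp
    then obtain z where z: "\<And>j k. j \<in> {1..V} \<Longrightarrow> k \<in> {1..V} \<Longrightarrow> Re (cnj (z j) * z k) = axial_gram y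
      (mink (p t j) (p t k)) (mink (p 0 j) (p 0 0)) (mink (p 0 j) (p 0 (V + 1)))
      (mink (p 0 k) (p 0 0)) (mink (p 0 k) (p 0 (V + 1)))"
      using projection[OF t(1)] t(3) by blast
    have "mink (p t j) (p t j) = - 1" if "j \<in> {1..V}" for j
      using on_hyp3[OF t(1), of j] that hyp3_D by auto
    then show "\<exists>z. \<forall>j\<in>{1..V}.
        Re (cnj (z j) * z j) = axial_gram y (- 1) (mink (p 0 j) (p 0 0)) (mink (p 0 j) (p 0 (V + 1)))
          (mink (p 0 j) (p 0 0)) (mink (p 0 j) (p 0 (V + 1))) \<and>
        Re (cnj (z j) * z (equator_next V j)) = axial_gram y (?m j)
          (mink (p 0 j) (p 0 0)) (mink (p 0 j) (p 0 (V + 1)))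
          (mink (p 0 (equator_next V j)) (p 0 0)) (mink (p 0 (equator_next V j)) (p 0 (V + 1)))"
      by (intro exI[of _ z] ballI) (simp only: z next_in equator[OF t(1)] simp_thms)
  qed auto
  have cosh: "?m j = - cosh (?e j)" if "j \<in> {1..V}" for j
  proof -
    have "?m j \<le> - 1" using on_hyp3 that next_in[OF that] by (intro mink_hyp3_le) auto
    then show ?thesis by (simp add: hdist_def cosh_arcosh_real)
  qed
  show thesis
  proof (rule signs_of_closing_relation[of "{1..V}" r ?e])
    show "(r j)\<^sup>2 = complex_of_real ((cosh (?e j))\<^sup>2 - 1)" if "j \<in> {1..V}" for j
      using r[OF that] cosh[OF that] by simp
    have "(\<Prod>j\<in>{1..V}. - of_real (cosh (?e j)) + r j) = (\<Prod>j\<in>{1..V}. of_real (?m j) + r j)"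
      by (intro prod.cong refl) (simp add: cosh)
    then show "(\<Prod>j\<in>{1..V}. - of_real (cosh (?e j)) + r j) = (\<Prod>j\<in>{1..V}. - 1)" using pr by simp
  qed (use that in auto)
qed

end

section \<open>Flexible suspensions\<close>

lemma vertex_pt_in_realization:
  assumes "simplicial_complex K" "v \<in> \<Union>K"
  shows "vertex_pt v \<in> realization K"
proof -
  obtain s where s: "s \<in> K" "v \<in> s" using assms(2) by blast
  have "\<forall>s\<in>K. \<forall>r. r \<subseteq> s \<and> r \<noteq> {} \<longrightarrow> r \<in> K"
    using assms(1) unfolding simplicial_complex_def by (elim conjE)
  then have "{v} \<in> K" using s by simp
  moreover have "vertex_pt v \<in> geom_simplex {v}" by (simp add: geom_simplex_def vertex_pt_def)
  ultimately show ?thesis unfolding realization_def by (rule UN_I)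
qed

lemma suspension_complex_edges:
  assumes "j \<in> {1..V}"
  shows "{j, 0} \<in> suspension_complex V" "{j, V + 1} \<in> suspension_complex V"
    "{j, equator_next V j} \<in> suspension_complex V"
proof -
  have *: "s \<in> suspension_complex V"
    if "s \<noteq> {}" "q \<in> {0, V + 1}" "s \<subseteq> {q, j, equator_next V j}" for s q
  proof -
    have "\<exists>q\<in>{0, V + 1}. \<exists>j\<in>{1..V}. s \<subseteq> {q, j, equator_next V j}"
      by (rule bexI[OF _ that(2)], rule bexI[OF _ assms], rule that(3))
    then show ?thesis
      using that(1) by (simp only: suspension_complex_def mem_Collect_eq simp_thms)
  qed
  show "{j, 0} \<in> suspension_complex V" by (rule *[of _ 0]) simp_all
  show "{j, V + 1} \<in> suspension_complex V" by (rule *[of _ "V + 1"]) simp_all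
  show "{j, equator_next V j} \<in> suspension_complex V" by (rule *[of _ 0]) simp_all
qed

lemma suspension_complex_vertices:
  assumes "1 \<le> V"
  shows "\<Union>(suspension_complex V) = {..V + 1}"
proof
  show "\<Union>(suspension_complex V) \<subseteq> {..V + 1}"
  proof
    fix v assume "v \<in> \<Union>(suspension_complex V)"
    then obtain q j where "q \<in> {0, V + 1}" "j \<in> {1..V}" "v \<in> {q, j, equator_next V j}"
      unfolding suspension_complex_def by (elim UnionE CollectE conjE bexE) (drule subsetD)
    then show "v \<in> {..V + 1}" by (auto simp: equator_next_def split: if_splits)
  qed
  have "v \<in> \<Union>(suspension_complex V)" if "v \<le> V + 1" for v
  proof -
    have one: "1 \<in> {1..V}" using assms by simp
    have "v \<in> {1..V} \<or> v = 0 \<or> v = V + 1" using that by auto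
    then consider "v \<in> {1..V}" | "v = 0" | "v = V + 1" by blast
    then show ?thesis
    proof cases
      case 1
      show ?thesis by (rule UnionI[OF suspension_complex_edges(1)[OF 1]]) simp
    next
      case 2
      show ?thesis by (rule UnionI[OF suspension_complex_edges(1)[OF one]]) (simp add: 2)
    next
      case 3
      show ?thesis by (rule UnionI[OF suspension_complex_edges(2)[OF one]]) (simp add: 3)
    qed
  qed
  then show "{..V + 1} \<subseteq> \<Union>(suspension_complex V)" by (intro subsetI) (simp only: atMost_iff)
qed

theorem theorem1:
  fixes V :: nat and P :: "(nat \<Rightarrow> real) \<Rightarrow> minkowski"
  assumes "suspension V P"
    and "nondegenerate_suspension V P"
    and "flexible (suspension_complex V) P"
  shows "\<exists>\<sigma> :: nat \<Rightarrow> real. (\<forall>j\<in>{1..V}. \<sigma> j \<in> {1, - 1}) \<and>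
    (\<Sum>j = 1..V. \<sigma> j * hdist (P (vertex_pt j)) (P (vertex_pt (equator_next V j)))) = 0"
proof -
  let ?K = "suspension_complex V"
  have V: "3 \<le> V" using assms(1) by (simp add: suspension_def)
  have vert: "\<Union>?K = {..V + 1}" using V suspension_complex_vertices by simp
  obtain F :: "real \<Rightarrow> (nat \<Rightarrow> real) \<Rightarrow> minkowski" where
    F: "(\<forall>t\<in>{0..1}. polyhedron ?K (F t)) \<and>
        (\<forall>v\<in>{..V + 1}. continuous_on {0..1} (\<lambda>t. F t (vertex_pt v))) \<and>
        (\<forall>x\<in>realization ?K. F 0 x = P x) \<and>
        (\<forall>t\<in>{0..1}. isometric_polyhedra ?K (F 0) (F t)) \<and>
        (\<exists>t\<in>{0..1}. \<not> congruent_polyhedra ?K (F 0) (F t))"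
    using assms(3) unfolding flexible_def vert by (rule exE)
  have poly: "polyhedron ?K (F t)" and iso: "isometric_polyhedra ?K (F 0) (F t)"
    if "t \<in> {0..1}" for t
    using F that by blast+
  have cont: "continuous_on {0..1} (\<lambda>t. F t (vertex_pt v))" if "v \<le> V + 1" for v
    using F that by (simp only: atMost_iff Ball_def)
  have start: "F 0 x = P x" if "x \<in> realization ?K" for x
    using F that by blast
  have flex: "\<exists>t\<in>{0..1}. \<not> congruent_polyhedra ?K (F 0) (F t)"
    using F by blast
  define p where "p t v = F t (vertex_pt v)" for t v
  have real: "vertex_pt v \<in> realization ?K" if "v \<le> V + 1" for v
    by (rule vertex_pt_in_realization[OF simplicial_complex_suspension_complex])
      (simp only: vert atMost_iff that)
  have hyp: "p t v \<in> hyp3" if "t \<in> {0..1}" "v \<le> V + 1" for t v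
    using poly[OF that(1)] real[OF that(2)] by (auto simp: polyhedron_def p_def)
  have p0: "p 0 v = P (vertex_pt v)" if "v \<le> V + 1" for v
    using start[OF real[OF that]] by (simp add: p_def)
  have nx: "equator_next V j \<le> V + 1" if "j \<in> {1..V}" for j using that by (auto simp: equator_next_def)
  have edge: "mink (p t v) (p t w) = mink (p 0 v) (p 0 w)"
    if t: "t \<in> {0..1}" and vw: "v \<noteq> w" "{v, w} \<in> ?K" for t v w
  proof -
    have "v \<le> V + 1" "w \<le> V + 1" using vw(2) vert by blast+
    moreover have "hdist (p t v) (p t w) = hdist (p 0 v) (p 0 w)"
      using iso[OF t] vw by (simp add: isometric_polyhedra_def p_def)
    moreover have "0 \<in> {0..1::real}" by simp
    ultimately show ?thesis using hdist_eq_iff[OF hyp hyp hyp hyp] t by blast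
  qed
  interpret suspension_motion V p
  proof
    show "span {p 0 0, p 0 (V + 1), p 0 j, p 0 (equator_next V j)} = UNIV" if j: "j \<in> {1..V}" for j
    proof (rule span_eq_UNIV_if_no_plane)
      show "{p 0 0, p 0 (V + 1), p 0 j, p 0 (equator_next V j)} \<subseteq> hyp3"
        using hyp nx[OF j] j by auto
      show "\<not> (\<exists>A. hyp_plane 2 A \<and> {p 0 0, p 0 (V + 1), p 0 j, p 0 (equator_next V j)} \<subseteq> A)"
        using assms(2) j nx[OF j] unfolding nondegenerate_suspension_def by (simp add: p0)
    qed simp
  next
    fix t :: real and j assume t: "t \<in> {0..1}" and j: "j \<in> {1..V}"
    have "j \<noteq> 0" "j \<noteq> V + 1" "j \<noteq> equator_next V j"
      using V j by (auto simp: equator_next_def)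
    then show "mink (p t j) (p t 0) = mink (p 0 j) (p 0 0)"
      "mink (p t j) (p t (V + 1)) = mink (p 0 j) (p 0 (V + 1))"
      "mink (p t j) (p t (equator_next V j)) = mink (p 0 j) (p 0 (equator_next V j))"
      using edge[OF t _ suspension_complex_edges(1)[OF j]] edge[OF t _ suspension_complex_edges(2)[OF j]]
        edge[OF t _ suspension_complex_edges(3)[OF j]]
      by blast+
  next
    show "continuous_on {0..1} (\<lambda>t. p t v)" if "v \<le> V + 1" for v
      unfolding p_def by (rule cont[OF that])
  next
    show "1 \<le> V" using V by simp
  qed (rule hyp)
  have "\<exists>s\<in>{0..1}. pole_product s \<noteq> pole_product 0"
  proof (rule ccontr)
    assume "\<not> ?thesis"
    then have "\<exists>f. hyp_isometry f \<and> (\<forall>v\<le>V + 1. p t v = f (p 0 v))" if "t \<in> {0..1}" for t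
      using that by (intro rigid_if_pole_product_constant) blast+
    then have "congruent_polyhedra ?K (F 0) (F t)" if "t \<in> {0..1}" for t
      using that unfolding congruent_polyhedra_def vert p_def atMost_iff Ball_def by blast
    then show False using flex by blast
  qed
  then obtain s where "s \<in> {0..1}" "pole_product s \<noteq> pole_product 0" by blast
  then obtain \<sigma> :: "nat \<Rightarrow> real" where \<sigma>: "\<And>j. \<sigma> j \<in> {1, - 1}"
    "(\<Sum>j = 1..V. \<sigma> j * hdist (p 0 j) (p 0 (equator_next V j))) = 0"
    using signed_sum_if_pole_product_varies by blast
  have "(\<Sum>j = 1..V. \<sigma> j * hdist (P (vertex_pt j)) (P (vertex_pt (equator_next V j)))) = 0"
    using \<sigma>(2) nx by (simp add: p0)
  then show ?thesis using \<sigma>(1) by blast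
qed

end
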